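(* Let $\varepsilon>0$ and let $s^{\varepsilon}=(s_1^{\varepsilon},s_2^{\varepsilon},s_3^{\varepsilon})$ be the profile of $\varepsilon$-good strategies. Then for every $x_1\in S$ the following hold. (1) If $\bar{x}_n=\bar{x}_n(s^{\varepsilon},x_1)$, then $\lim_{n\to\infty}\bar{x}_n=(p_3,p_3,p_3)$. (2) (One player deviates.) For every $i\in\{1,2,3\}$ and every strategy $s_i:S\to\{I,NI\}$ of player $i$, if $\bar{x}_n$ is the trajectory starting at $x_1$ of the profile in which player $i$ uses $s_i$ and the other two players use their $\varepsilon$-good strategies, then $\limsup_{n\to\infty}\bar{x}_n^i\leq p_3+\varepsilon$. (3) (Two players deviate.) For all $i,j,k$ with $\{i,j,k\}=\{1,2,3\}$ and all strategies $s_j,s_k:S\to\{I,NI\}$, if $\bar{x}_n$ is the trajectory starting at $x_1$ of the profile in which player $i$ uses $s_i^{\varepsilon}$ and players $j,k$ use $s_j,s_k$, then $$\limsup_{n\to\infty}(\bar{x}_n^j+\bar{x}_n^k)\leq 2p_3,\qquad \liminf_{n\to\infty}\bar{x}_n^i\geq r_0,$$ $$\lim_{n\to\infty}\mathrm{dist}\bigl(\bar{x}_n,\{x\in S:\ x_j\leq x_i+\varepsilon,\ x_k\leq x_i+\varepsilon\}\bigr)=0.$$ Moreover, if the payoff vector of a strategy profile $s$ in the repeated game with initial point $x_1$ is defined as the Banach limit $\mathrm{Lim}\,\bar{x}_T(s,x_1)$, then $s^{\varepsilon}$ is a safe and strong $\varepsilon$-Nash equilibrium of the repeated game.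
   Context: Stage game. There are three players $1,2,3$, each with the two actions $I$ (invest) and $NI$ (not invest). The game is symmetric: if exactly $n$ players invest, each investing player receives $p_n$ ($n=1,2,3$) and each non-investing player receives $r_n$ ($n=0,1,2$). Let $G:\{I,NI\}^3\to\mathbb{R}^3$ be the resulting vector payoff function (coordinate $i$ of $G(a)$ is the payoff of player $i$ under action profile $a$). Standing assumptions on the real numbers $r_0,r_1,r_2,p_1,p_2,p_3$: $0<r_0<r_1<r_2$; $0<p_1<p_2<p_3$; $p_1<r_0$; $3r_0<p_1+2r_1<2p_2+r_2<3p_3$; $p_1+r_1<2p_3$; $p_2<r_2$. Let $S\subset\mathbb{R}^3$ be the convex hull of the eight payoff vectors $G(a)$, $a\in\{I,NI\}^3$. Repeated game. A strategy of player $i$ is an arbitrary function $s_i:S\to\{I,NI\}$; a strategy profile is $s=(s_1,s_2,s_3):S\to\{I,NI\}^3$. Put $\varphi=G\circ s:S\to S$. For $x_1\in S$ the trajectory $\bar{x}_n=\bar{x}_n(s,x_1)=(\bar{x}_n^1,\bar{x}_n^2,\bar{x}_n^3)$ is defined by $\bar{x}_1=x_1$ and $\bar{x}_{n+1}=\frac{n\bar{x}_n+\varphi(\bar{x}_n)}{n+1}$ for $n\ge 1$. $\varepsilon$-good strategy. For $\varepsilon>0$ and $\{i,j,k\}=\{1,2,3\}$ let $\Omega_i^{\varepsilon}=\{x\in S: x_i>x_j-\varepsilon \text{ and } x_i>x_k-\varepsilon\}$, $W_i=\{x\in S: x_i<r_0 \text{ or } x_j+x_k>2p_3\}$, $V_i=\Omega_i^{\varepsilon}\setminus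 W_i$. The $\varepsilon$-good strategy of player $i$ is $s_i^{\varepsilon}(x)=I$ if $x\in V_i$ and $s_i^{\varepsilon}(x)=NI$ if $x\in S\setminus V_i$. $\mathrm{Lim}$ denotes a fixed Banach limit on bounded real sequences (a positive, shift-invariant continuous linear functional on $\ell^\infty$ that agrees with the limit on convergent sequences; in particular $\liminf\le\mathrm{Lim}\le\limsup$), applied coordinatewise to bounded sequences in $\mathbb{R}^3$. Equilibrium notions, with payoffs $\mathrm{Lim}\,\bar{x}_T(s,x_1)$. A profile $s^*$ is a strong $\varepsilon$-Nash equilibrium if for every $x_1\in S$, every nonempty coalition $K\subset\{1,2,3\}$ and every profile $s$ with $s_l=s_l^*$ for all $l\notin K$, there is a player $i\in K$ whose payoff under $s$ is at most his payoff under $s^*$ plus $\varepsilon$. It is safe (with constant $\varepsilon$) if for every $x_1\in S$, every player $i$ and every profile $s$ with $s_i=s_i^*$, the payoff of player $i$ under $s$ is at least $r_0$ (the stage-game payoff at the Nash equilibrium $(NI,NI,NI)$), and the payoff of every other player under $s$ is at most the payoff of player $i$ under $s$ plus $\varepsilon$. *)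

theory Defs
  imports "HOL-Analysis.Analysis"
begin

text \<open>The players are the three elements \<open>1\<close>, \<open>2\<close>, \<open>3\<close> of the numeral type \<^typ>\<open>3\<close>.\<close>

datatype action = Invest | NotInvest

type_synonym action_profile = "3 \<Rightarrow> action"

text \<open>A strategy is a total function on \<open>\<real>\<^sup>3\<close>; only its values on the feasible set matter, since
  trajectories that start in the feasible set stay in it (lemma \<open>trajectory_in_feasible\<close>).\<close>

type_synonym strategy = "real^3 \<Rightarrow> action"

type_synonym strategy_profile = "3 \<Rightarrow> strategy"

text \<open>Of the payoff sequences only \<open>p 1\<close>, \<open>p 2\<close>, \<open>p 3\<close> and \<open>r 0\<close>, \<open>r 1\<close>, \<open>r 2\<close> are ever used:
  an investor counts himself.\<close>

definition stage_payoff :: "(nat \<Rightarrow> real) \<Rightarrow> (nat \<Rightarrow> real) \<Rightarrow> action_profile \<Rightarrow> real^3" where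
  "stage_payoff r p a =
    (let n = card {j. a j = Invest} in \<chi> i. if a i = Invest then p n else r n)"

definition feasible :: "(nat \<Rightarrow> real) \<Rightarrow> (nat \<Rightarrow> real) \<Rightarrow> (real^3) set" where
  "feasible r p = convex hull (range (stage_payoff r p))"

definition next_payoff ::
  "(nat \<Rightarrow> real) \<Rightarrow> (nat \<Rightarrow> real) \<Rightarrow> strategy_profile \<Rightarrow> real^3 \<Rightarrow> real^3" where
  "next_payoff r p s x = stage_payoff r p (\<lambda>i. s i x)"

text \<open>The trajectory is indexed from \<open>1\<close>; the value at index \<open>0\<close> is a dummy.\<close>

primrec trajectory ::
  "(nat \<Rightarrow> real) \<Rightarrow> (nat \<Rightarrow> real) \<Rightarrow> strategy_profile \<Rightarrow> real^3 \<Rightarrow> nat \<Rightarrow> real^3" where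
  "trajectory r p s x\<^sub>1 0 = x\<^sub>1"
| "trajectory r p s x\<^sub>1 (Suc n) =
    (if n = 0 then x\<^sub>1
     else (real n *\<^sub>R trajectory r p s x\<^sub>1 n + next_payoff r p s (trajectory r p s x\<^sub>1 n))
            /\<^sub>R real (n + 1))"

definition Omega_set :: "(nat \<Rightarrow> real) \<Rightarrow> (nat \<Rightarrow> real) \<Rightarrow> real \<Rightarrow> 3 \<Rightarrow> (real^3) set" where
  "Omega_set r p \<epsilon> i = {x \<in> feasible r p. \<forall>j. j \<noteq> i \<longrightarrow> x $ i > x $ j - \<epsilon>}"

definition W_set :: "(nat \<Rightarrow> real) \<Rightarrow> (nat \<Rightarrow> real) \<Rightarrow> 3 \<Rightarrow> (real^3) set" where
  "W_set r p i = {x \<in> feasible r p. x $ i < r 0 \<or> (\<Sum>j\<in>UNIV - {i}. x $ j) > 2 * p 3}"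

definition V_set :: "(nat \<Rightarrow> real) \<Rightarrow> (nat \<Rightarrow> real) \<Rightarrow> real \<Rightarrow> 3 \<Rightarrow> (real^3) set" where
  "V_set r p \<epsilon> i = Omega_set r p \<epsilon> i - W_set r p i"

definition good_profile :: "(nat \<Rightarrow> real) \<Rightarrow> (nat \<Rightarrow> real) \<Rightarrow> real \<Rightarrow> strategy_profile" where
  "good_profile r p \<epsilon> i x = (if x \<in> V_set r p \<epsilon> i then Invest else NotInvest)"

text \<open>As \<^typ>\<open>nat\<close> carries the discrete topology, \<^typ>\<open>nat \<Rightarrow>\<^sub>C real\<close> is the Banach space
  \<open>\<ell>\<^sup>\<infinity>\<close> of bounded real sequences with the supremum norm.\<close>

definition banach_limit :: "((nat \<Rightarrow>\<^sub>C real) \<Rightarrow> real) \<Rightarrow> bool" where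
  "banach_limit L \<longleftrightarrow>
    bounded_linear L \<and>
    (\<forall>u. (\<forall>n. apply_bcontfun u n \<ge> 0) \<longrightarrow> L u \<ge> 0) \<and>
    (\<forall>u v. (\<forall>n. apply_bcontfun v n = apply_bcontfun u (Suc n)) \<longrightarrow> L v = L u) \<and>
    (\<forall>u l. apply_bcontfun u \<longlonglongrightarrow> l \<longrightarrow> L u = l)"

text \<open>The bijection \<^const>\<open>Bcontfun\<close> is meaningful on bounded sequences only; see
  lemma \<open>apply_Bcontfun_trajectory\<close>.\<close>

definition repeated_payoff ::
  "((nat \<Rightarrow>\<^sub>C real) \<Rightarrow> real) \<Rightarrow> (nat \<Rightarrow> real) \<Rightarrow> (nat \<Rightarrow> real) \<Rightarrow> strategy_profile \<Rightarrow> real^3 \<Rightarrow> real^3"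
where
  "repeated_payoff L r p s x\<^sub>1 = (\<chi> i. L (Bcontfun (\<lambda>n. trajectory r p s x\<^sub>1 (Suc n) $ i)))"

definition strong_eps_Nash ::
  "((nat \<Rightarrow>\<^sub>C real) \<Rightarrow> real) \<Rightarrow> (nat \<Rightarrow> real) \<Rightarrow> (nat \<Rightarrow> real) \<Rightarrow> real \<Rightarrow> strategy_profile \<Rightarrow> bool"
where
  "strong_eps_Nash L r p \<epsilon> s' \<longleftrightarrow>
    (\<forall>x\<^sub>1 \<in> feasible r p. \<forall>K. K \<noteq> {} \<longrightarrow>
      (\<forall>s. (\<forall>l. l \<notin> K \<longrightarrow> (\<forall>x \<in> feasible r p. s l x = s' l x)) \<longrightarrow>
        (\<exists>i\<in>K. repeated_payoff L r p s x\<^sub>1 $ i \<le> repeated_payoff L r p s' x\<^sub>1 $ i + \<epsilon>)))"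

definition safe_profile ::
  "((nat \<Rightarrow>\<^sub>C real) \<Rightarrow> real) \<Rightarrow> (nat \<Rightarrow> real) \<Rightarrow> (nat \<Rightarrow> real) \<Rightarrow> real \<Rightarrow> strategy_profile \<Rightarrow> bool"
where
  "safe_profile L r p \<epsilon> s' \<longleftrightarrow>
    (\<forall>x\<^sub>1 \<in> feasible r p. \<forall>i s. (\<forall>x \<in> feasible r p. s i x = s' i x) \<longrightarrow>
      repeated_payoff L r p s x\<^sub>1 $ i \<ge> r 0 \<and>
      (\<forall>j. j \<noteq> i \<longrightarrow>
        repeated_payoff L r p s x\<^sub>1 $ j \<le> repeated_payoff L r p s x\<^sub>1 $ i + \<epsilon>))"

lemma next_payoff_in_feasible: "next_payoff r p s x \<in> feasible r p"
  unfolding next_payoff_def feasible_def by (intro hull_inc rangeI)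

lemma trajectory_in_feasible:
  assumes "x\<^sub>1 \<in> feasible r p"
  shows "trajectory r p s x\<^sub>1 n \<in> feasible r p"
proof (induction n)
  case (Suc n)
  let ?x = "trajectory r p s x\<^sub>1 n" and ?y = "next_payoff r p s (trajectory r p s x\<^sub>1 n)"
  have "convex (feasible r p)"
    by (simp add: feasible_def)
  then have "(real n / real (n + 1)) *\<^sub>R ?x + (1 / real (n + 1)) *\<^sub>R ?y \<in> feasible r p"
    using Suc next_payoff_in_feasible by (rule convexD) (auto simp: field_simps)
  also have "(real n / real (n + 1)) *\<^sub>R ?x + (1 / real (n + 1)) *\<^sub>R ?y
      = (real n *\<^sub>R ?x + ?y) /\<^sub>R real (n + 1)"
    by (simp add: scaleR_right_distrib divide_inverse mult.commute)
  finally show ?case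
    using assms by simp
qed (use assms in simp)

lemma bounded_feasible: "bounded (feasible r p)"
proof -
  have "finite (UNIV :: action set)"
    by (rule finite_subset[of _ "{Invest, NotInvest}"]) (auto intro: action.exhaust)
  then have "finite (UNIV :: action_profile set)"
    using finite_UNIV_fun[where 'a = 3 and 'b = action] by simp
  then show ?thesis
    unfolding feasible_def by (intro bounded_convex_hull finite_imp_bounded finite_imageI)
qed

lemma apply_Bcontfun_trajectory:
  assumes "x\<^sub>1 \<in> feasible r p"
  shows "apply_bcontfun (Bcontfun (\<lambda>n. trajectory r p s x\<^sub>1 (Suc n) $ i)) n
    = trajectory r p s x\<^sub>1 (Suc n) $ i"
proof -
  have "bounded ((\<lambda>x. x $ i) ` feasible r p)"
    by (intro bounded_linear_image bounded_feasible bounded_linear_vec_nth)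
  then have "bounded (range (\<lambda>n. trajectory r p s x\<^sub>1 (Suc n) $ i))"
    by (rule bounded_subset) (use trajectory_in_feasible[OF assms] in blast)
  then have "(\<lambda>n. trajectory r p s x\<^sub>1 (Suc n) $ i) \<in> bcontfun"
    by (simp add: bcontfun_def)
  then show ?thesis
    by (simp add: Bcontfun_inverse)
qed

end

theory Submission
  imports Defs
begin

text \<open>For a linear functional \<open>f\<close>, the quantity \<open>n * (f (x n) - a)\<close> changes in step \<open>n\<close> by
  \<open>f y - a\<close>, where \<open>y\<close> is the current stage payoff. Hence it stays bounded above if \<open>f y \<le> a\<close> whenever
  \<open>f (x n) > a\<close>, and then the limit superior of \<open>f (x n)\<close> is at most \<open>a\<close>. A player who uses the good
  strategy does not invest when one of its constraints fails, and by not investing it produces such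
  a drift for each of the functionals \<open>x $ j + x $ k\<close>, \<open>- x $ i\<close> and \<open>x $ j - x $ i\<close>. This
  controls all deviations.

  If all players are good, the leader always invests. Suppose that not all three ever invest at
  once. Then the stage payoff sums, and eventually the coordinate sum of \<open>x n\<close>, are bounded away from
  \<open>3 * r 0\<close> and \<open>3 * p 3\<close>. It follows that a non-investor is behind the leader by a fixed amount.
  Since non-investors receive more than investors, the differences of the coordinates tend to \<open>0\<close>,
  a contradiction. So all three invest at some time, and from then on the trajectory moves straight
  towards \<open>(p 3, p 3, p 3)\<close> inside the region where they keep investing.\<close>

section \<open>The three players and the number of investors\<close>

lemma triple_distinct:
  fixes i j k :: 3
  assumes "{i, j, k} = UNIV"
  shows "i \<noteq> j" "i \<noteq> k" "j \<noteq> k"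
proof -
  have "card {i, j, k} = 3"
    using assms by simp
  then show "i \<noteq> j" "i \<noteq> k" "j \<noteq> k"
    by (auto simp: card_insert_if split: if_splits)
qed

lemma sum_triple:
  fixes i j k :: 3 and f :: "3 \<Rightarrow> 'a::comm_monoid_add"
  assumes "{i, j, k} = UNIV"
  shows "sum f UNIV = f i + f j + f k"
  using triple_distinct[OF assms] by (simp add: assms[symmetric] add.assoc)

lemma sum_others_triple:
  fixes i j k :: 3 and f :: "3 \<Rightarrow> 'a::comm_monoid_add"
  assumes "{i, j, k} = UNIV"
  shows "sum f (UNIV - {i}) = f j + f k"
proof -
  have "UNIV - {i} = {j, k}"
    using triple_distinct[OF assms] by (auto simp: assms[symmetric])
  then show ?thesis
    using triple_distinct[OF assms] by simp
qed

lemma triple_cases: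
  fixes i j k l :: 3
  assumes "{i, j, k} = UNIV"
  obtains "l = i" | "l = j" | "l = k"
  using assms by blast

lemma ex_triple:
  fixes i j :: 3
  assumes "i \<noteq> j"
  shows "\<exists>k. {i, j, k} = UNIV"
proof -
  have "\<exists>k. k \<notin> {i, j}"
  proof (rule ccontr)
    assume "\<nexists>k. k \<notin> {i, j}"
    then have "{i, j} = UNIV"
      by blast
    then have "card {i, j} = 3"
      by simp
    then show False
      using assms by simp
  qed
  then obtain k where k: "k \<notin> {i, j}" ..
  have "{i, j, k} = UNIV"
    by (rule card_subset_eq) (use assms k in auto)
  then show ?thesis ..
qed

lemma ex_triple1:
  fixes i :: 3
  shows "\<exists>j k. {i, j, k} = UNIV"
proof -
  \<comment> \<open>Arithmetic in the type \<open>3\<close> is modulo 3, so \<open>i + 1\<close> is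
    another player.\<close>
  have "i + 1 \<noteq> i"
    by simp
  then show ?thesis
    using ex_triple by metis
qed

text \<open>A sum of three indicators can be evaluated by a case split on the three actions.\<close>

lemma card_investors:
  fixes a :: action_profile
  assumes "{i, j, k} = UNIV"
  shows "card {l. a l = Invest}
    = of_bool (a i = Invest) + of_bool (a j = Invest) + of_bool (a k = Invest)"
proof -
  have "card {l. a l = Invest} = (\<Sum>l\<in>UNIV. of_bool (a l = Invest))"
    by (simp add: of_bool_def sum.If_cases)
  then show ?thesis
    by (simp only: sum_triple[OF assms])
qed

section \<open>Drift of linear functionals along a trajectory\<close>

text \<open>The recursion averages from index 1 on; the step from index 0 only repeats
  \<open>x\<^sub>1\<close>, hence the assumption \<open>1 \<le> n\<close>.\<close>

lemma trajectory_Suc_scaled: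
  assumes "1 \<le> n"
  shows "real (Suc n) *\<^sub>R trajectory r p s x\<^sub>1 (Suc n)
    = real n *\<^sub>R trajectory r p s x\<^sub>1 n + next_payoff r p s (trajectory r p s x\<^sub>1 n)"
  using assms by simp

lemma excess_Suc:
  fixes f :: "real^3 \<Rightarrow> real"
  assumes "linear f" and "1 \<le> n"
  shows "real (Suc n) * (f (trajectory r p s x\<^sub>1 (Suc n)) - a)
    = real n * (f (trajectory r p s x\<^sub>1 n) - a)
      + (f (next_payoff r p s (trajectory r p s x\<^sub>1 n)) - a)"
proof -
  have "real (Suc n) * f (trajectory r p s x\<^sub>1 (Suc n))
      = f (real (Suc n) *\<^sub>R trajectory r p s x\<^sub>1 (Suc n))"
    by (simp only: linear_scale[OF assms(1)] real_scaleR_def)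
  also have "\<dots> = real n * f (trajectory r p s x\<^sub>1 n) + f (next_payoff r p s (trajectory r p s x\<^sub>1 n))"
    by (simp only: trajectory_Suc_scaled[OF assms(2)] linear_add[OF assms(1)]
        linear_scale[OF assms(1)] real_scaleR_def)
  finally show ?thesis
    by (simp add: algebra_simps)
qed

text \<open>Above the level \<open>a\<close> the scaled excess does not increase. At or below it the
  scaled excess is nonpositive, so its next value is at most the change in one step.\<close>

lemma excess_bounded:
  fixes f :: "real^3 \<Rightarrow> real"
  assumes f: "linear f"
    and drift: "\<And>n. 1 \<le> n \<Longrightarrow> a < f (trajectory r p s x\<^sub>1 n) \<Longrightarrow>
      f (next_payoff r p s (trajectory r p s x\<^sub>1 n)) \<le> a"
  shows "\<exists>C. \<forall>n\<ge>1. real n * (f (trajectory r p s x\<^sub>1 n) - a) \<le> C"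
proof -
  have "bounded (f ` feasible r p)"
    using f by (intro bounded_linear_image bounded_feasible) (simp add: linear_linear)
  then obtain M where M: "\<And>x. x \<in> feasible r p \<Longrightarrow> \<bar>f x\<bar> \<le> M"
    by (auto simp: bounded_iff)
  \<comment> \<open>The first term covers the start \<open>n = 1\<close>, the second one step from a
    nonpositive excess.\<close>
  define C where "C = max (f x\<^sub>1 - a) (M - a)"
  have "real n * (f (trajectory r p s x\<^sub>1 n) - a) \<le> C" if "1 \<le> n" for n
    using that
  proof (induction n rule: dec_induct)
    case base
    then show ?case
      by (simp add: C_def)
  next
    case (step n)
    let ?x = "trajectory r p s x\<^sub>1 n"
    have e: "real (Suc n) * (f (trajectory r p s x\<^sub>1 (Suc n)) - a)
        = real n * (f ?x - a) + (f (next_payoff r p s ?x) - a)"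
      by (rule excess_Suc) (use f step in auto)
    show ?case
    proof (cases "a < f ?x")
      case True
      then show ?thesis
        using drift[OF step(1) True] e step.IH by linarith
    next
      case False
      then have "real n * (f ?x - a) \<le> 0"
        by (simp add: mult_nonneg_nonpos)
      moreover have "f (next_payoff r p s ?x) \<le> M"
        using M[OF next_payoff_in_feasible] by (meson abs_le_iff)
      ultimately show ?thesis
        using e unfolding C_def by linarith
    qed
  qed
  then show ?thesis
    by blast
qed

lemma eventually_le_of_scaled:
  fixes z :: "nat \<Rightarrow> real"
  assumes "\<forall>n\<ge>1. real n * (z n - a) \<le> C" and "0 < e"
  shows "\<forall>\<^sub>F n in sequentially. z n \<le> a + e"
proof -
  have "(\<lambda>n. C / real n) \<longlonglongrightarrow> 0"
    by (rule lim_const_over_n)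
  then have "\<forall>\<^sub>F n in sequentially. C / real n < e"
    using assms(2) by (rule order_tendstoD)
  then show ?thesis
    using eventually_ge_at_top[of 1]
  proof eventually_elim
    case (elim n)
    then have "z n - a \<le> C / real n"
      using assms(1) by (simp add: field_simps)
    then show ?case
      using elim by simp
  qed
qed

lemma trajectory_eventually_le:
  fixes f :: "real^3 \<Rightarrow> real"
  assumes "linear f"
    and "\<And>n. 1 \<le> n \<Longrightarrow> a < f (trajectory r p s x\<^sub>1 n) \<Longrightarrow>
      f (next_payoff r p s (trajectory r p s x\<^sub>1 n)) \<le> a"
    and "0 < e"
  shows "\<forall>\<^sub>F n in sequentially. f (trajectory r p s x\<^sub>1 n) \<le> a + e"
proof -
  obtain C where "\<forall>n\<ge>1. real n * (f (trajectory r p s x\<^sub>1 n) - a) \<le> C"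
    using excess_bounded[OF assms(1), of a r p s x\<^sub>1] assms(2) by blast
  then show ?thesis
    by (rule eventually_le_of_scaled) (rule assms(3))
qed

section \<open>From eventual bounds to limsup, liminf and distances\<close>

lemma limsup_le_of_eventually:
  fixes z :: "nat \<Rightarrow> real"
  assumes "\<And>e. 0 < e \<Longrightarrow> \<forall>\<^sub>F n in sequentially. z n \<le> a + e"
  shows "limsup (\<lambda>n. ereal (z n)) \<le> ereal a"
proof (rule ereal_le_epsilon2)
  fix e :: real
  assume "0 < e"
  then show "limsup (\<lambda>n. ereal (z n)) \<le> ereal a + ereal e"
    using assms by (intro Limsup_bounded) simp
qed

lemma liminf_ge_of_eventually:
  fixes z :: "nat \<Rightarrow> real"
  assumes "\<And>e. 0 < e \<Longrightarrow> \<forall>\<^sub>F n in sequentially. a \<le> z n + e"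
  shows "ereal a \<le> liminf (\<lambda>n. ereal (z n))"
proof (rule ereal_le_epsilon2)
  fix e :: real
  assume "0 < e"
  then have "\<forall>\<^sub>F n in sequentially. ereal (a - e) \<le> ereal (z n)"
    using assms[of e] by (auto elim!: eventually_mono)
  then have "ereal (a - e) \<le> liminf (\<lambda>n. ereal (z n))"
    by (rule Liminf_bounded)
  then show "ereal a \<le> liminf (\<lambda>n. ereal (z n)) + ereal e"
    by (cases "liminf (\<lambda>n. ereal (z n))") auto
qed

lemma compact_feasible: "compact (feasible r p)"
proof -
  have "finite (UNIV :: action set)"
    by (rule finite_subset[of _ "{Invest, NotInvest}"]) (auto intro: action.exhaust)
  then have "finite (UNIV :: action_profile set)"
    using finite_UNIV_fun[where 'a = 3 and 'b = action] by simp
  then show ?thesis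
    unfolding feasible_def by (intro finite_imp_compact_convex_hull finite_imageI)
qed

text \<open>Points of \<open>S\<close> at distance at least \<open>d\<close> from the sublevel set
  form a compact set on which \<open>max (f y) (g y)\<close> is positive, hence at least some
  \<open>m > 0\<close>. Values at most \<open>m / 2\<close> keep the sequence out of it.\<close>

lemma infdist_sublevel_tendsto_0:
  fixes x :: "nat \<Rightarrow> 'a::metric_space" and f g :: "'a \<Rightarrow> real"
  assumes "compact S" and x: "\<And>n. x n \<in> S"
    and cont: "continuous_on S f" "continuous_on S g"
    and f: "\<And>e. 0 < e \<Longrightarrow> \<forall>\<^sub>F n in sequentially. f (x n) \<le> e"
    and g: "\<And>e. 0 < e \<Longrightarrow> \<forall>\<^sub>F n in sequentially. g (x n) \<le> e"
  shows "(\<lambda>n. infdist (x n) {y \<in> S. f y \<le> 0 \<and> g y \<le> 0}) \<longlonglongrightarrow> 0"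
proof -
  let ?A = "{y \<in> S. f y \<le> 0 \<and> g y \<le> 0}"
  have "\<forall>\<^sub>F n in sequentially. infdist (x n) ?A < d" if "0 < d" for d
  proof -
    define T where "T = S \<inter> {y. d \<le> infdist y ?A}"
    have "closed {y. d \<le> infdist y ?A}"
      by (intro closed_Collect_le continuous_intros)
    then have T: "compact T"
      unfolding T_def using \<open>compact S\<close> by (rule compact_Int_closed[rotated])
    have pos: "0 < max (f y) (g y)" if "y \<in> T" for y
    proof (rule ccontr)
      assume "\<not> 0 < max (f y) (g y)"
      then have "y \<in> ?A"
        using that by (auto simp: T_def)
      then show False
        using that \<open>0 < d\<close> by (simp add: T_def)
    qed
    obtain m where m: "0 < m" "\<And>y. y \<in> T \<Longrightarrow> m \<le> max (f y) (g y)"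
    proof (cases "T = {}")
      case True
      then show ?thesis
        using that[of 1] by simp
    next
      case False
      have "continuous_on T (\<lambda>y. max (f y) (g y))"
        using cont by (intro continuous_intros) (auto simp: T_def intro: continuous_on_subset)
      then obtain y where "y \<in> T" "\<forall>z\<in>T. max (f y) (g y) \<le> max (f z) (g z)"
        using continuous_attains_inf[OF T False] by blast
      then show ?thesis
        using that[of "max (f y) (g y)"] pos by blast
    qed
    have "\<forall>\<^sub>F n in sequentially. f (x n) \<le> m / 2" "\<forall>\<^sub>F n in sequentially. g (x n) \<le> m / 2"
      using f[of "m / 2"] g[of "m / 2"] m(1) by simp_all
    then show ?thesis
    proof eventually_elim
      case (elim n)
      then have "x n \<notin> T"
        using m(1) m(2)[of "x n"] by fastforce
      then show ?case
        using x by (simp add: T_def)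
    qed
  qed
  then show ?thesis
    by (simp add: tendsto_iff infdist_nonneg)
qed

section \<open>Bounds for Banach limits\<close>

text \<open>Shift invariance removes the initial terms at which the bound may fail; positivity then
  applies to the constant sequence minus the shifted one.\<close>

lemma banach_limit_le:
  assumes L: "banach_limit L"
    and u: "\<And>e. 0 < e \<Longrightarrow> \<forall>\<^sub>F n in sequentially. apply_bcontfun u n \<le> a + e"
  shows "L u \<le> a"
proof (rule field_le_epsilon)
  fix e :: real
  assume "0 < e"
  interpret L: bounded_linear L
    using L by (simp add: banach_limit_def)
  have shift_bcontfun: "(\<lambda>n. apply_bcontfun u (n + k)) \<in> bcontfun" for k
    using bounded_subset[OF bounded_apply_bcontfun[of u], of "range (\<lambda>n. apply_bcontfun u (n + k))"]
    by (auto simp: bcontfun_def)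
  define w where "w k = Bcontfun (\<lambda>n. apply_bcontfun u (n + k))" for k
  have w: "apply_bcontfun (w k) n = apply_bcontfun u (n + k)" for k n
    by (simp add: w_def Bcontfun_inverse[OF shift_bcontfun])
  have Lw: "L (w k) = L u" for k
  proof (induction k)
    case 0
    then show ?case
      by (simp add: w_def apply_bcontfun_inverse)
  next
    case (Suc k)
    have "L (w (Suc k)) = L (w k)"
      using L by (simp add: banach_limit_def w)
    then show ?case
      using Suc by simp
  qed
  have const: "L (const_bcontfun c) = c" for c
    using L by (simp add: banach_limit_def const_bcontfun.rep_eq)
  obtain k where k: "\<And>n. k \<le> n \<Longrightarrow> apply_bcontfun u n \<le> a + e"
    using u[OF \<open>0 < e\<close>] by (auto simp: eventually_sequentially)
  have "0 \<le> L (const_bcontfun (a + e) - w k)"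
    using L k by (simp add: banach_limit_def w const_bcontfun.rep_eq)
  then show "L u \<le> a + e"
    by (simp add: L.diff const Lw)
qed

text \<open>Payoffs are Banach limits of single coordinates. Expanding \<open>f\<close> in the
  standard basis moves it inside \<open>L\<close> by linearity.\<close>

lemma banach_limit_linear_le:
  fixes f :: "real^3 \<Rightarrow> real"
  assumes L: "banach_limit L" and x\<^sub>1: "x\<^sub>1 \<in> feasible r p" and f: "linear f"
    and ev: "\<And>e. 0 < e \<Longrightarrow> \<forall>\<^sub>F n in sequentially. f (trajectory r p s x\<^sub>1 n) \<le> a + e"
  shows "f (repeated_payoff L r p s x\<^sub>1) \<le> a"
proof -
  interpret L: bounded_linear L
    using L by (simp add: banach_limit_def)
  define u where "u i = Bcontfun (\<lambda>n. trajectory r p s x\<^sub>1 (Suc n) $ i)" for i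
  define v where "v = (\<Sum>i\<in>UNIV. f (axis i 1) *\<^sub>R u i)"
  have expand: "f y = (\<Sum>i\<in>UNIV. f (axis i 1) * y $ i)" for y
  proof -
    have "f y = f (\<Sum>i\<in>UNIV. y $ i *\<^sub>R axis i 1)"
      by (simp only: basis_expansion[of y, unfolded scalar_mult_eq_scaleR])
    then show ?thesis
      by (simp add: linear_sum[OF f] linear_scale[OF f] mult.commute)
  qed
  have "apply_bcontfun v n = f (trajectory r p s x\<^sub>1 (Suc n))" for n
    unfolding v_def expand[of "trajectory r p s x\<^sub>1 (Suc n)"]
    by (simp add: sum_3 u_def apply_Bcontfun_trajectory[OF x\<^sub>1] del: trajectory.simps)
  \<comment> \<open>The payoff sequence starts at index 1 of the trajectory, hence the
    shift.\<close>
  moreover have "\<forall>\<^sub>F n in sequentially. f (trajectory r p s x\<^sub>1 (Suc n)) \<le> a + e" if "0 < e" for e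
    by (rule eventually_compose_filterlim[OF ev[OF that] filterlim_Suc])
  ultimately have "L v \<le> a"
    using L by (intro banach_limit_le) (simp_all del: trajectory.simps)
  also have "L v = f (repeated_payoff L r p s x\<^sub>1)"
    unfolding expand[of "repeated_payoff L r p s x\<^sub>1"]
    by (simp add: v_def L.sum L.scaleR repeated_payoff_def u_def del: trajectory.simps)
  finally show ?thesis .
qed

section \<open>The game and its stage payoffs\<close>

text \<open>Agreement is required only on the feasible set, as in both equilibrium notions;
  trajectories see nothing else.\<close>

definition follows ::
  "(nat \<Rightarrow> real) \<Rightarrow> (nat \<Rightarrow> real) \<Rightarrow> real \<Rightarrow> strategy_profile \<Rightarrow> 3 \<Rightarrow> bool" where
  "follows r p \<epsilon> s i \<longleftrightarrow> (\<forall>x \<in> feasible r p. s i x = good_profile r p \<epsilon> i x)"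

locale investment_game =
  fixes r p :: "nat \<Rightarrow> real" and \<epsilon> :: real
  assumes r_pos: "0 < r 0" and r01: "r 0 < r 1" and r12: "r 1 < r 2"
    and p_pos: "0 < p 1" and p12: "p 1 < p 2" and p23: "p 2 < p 3"
    and p1_r0: "p 1 < r 0"
    and sum01: "3 * r 0 < p 1 + 2 * r 1" and sum12: "p 1 + 2 * r 1 < 2 * p 2 + r 2"
    and sum23: "2 * p 2 + r 2 < 3 * p 3"
    and p1_r1: "p 1 + r 1 < 2 * p 3"
    and p2_r2: "p 2 < r 2"
    and eps_pos: "\<epsilon> > 0"
begin

abbreviation good where "good \<equiv> good_profile r p \<epsilon>"

text \<open>Membership in \<open>V_set\<close> as linear inequalities. The last two are weak because
  they negate the strict ones defining \<open>W_set\<close>.\<close>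

lemma good_Invest_iff:
  assumes "{i, j, k} = UNIV" and "x \<in> feasible r p"
  shows "good i x = Invest \<longleftrightarrow>
    x $ j - \<epsilon> < x $ i \<and> x $ k - \<epsilon> < x $ i \<and> r 0 \<le> x $ i \<and> x $ j + x $ k \<le> 2 * p 3"
proof -
  have "(\<forall>l. l \<noteq> i \<longrightarrow> x $ l - \<epsilon> < x $ i) \<longleftrightarrow> x $ j - \<epsilon> < x $ i \<and> x $ k - \<epsilon> < x $ i"
    using triple_distinct[OF assms(1)] triple_cases[OF assms(1)] by metis
  then show ?thesis
    using assms(2) sum_others_triple[OF assms(1), of "\<lambda>l. x $ l"]
    by (auto simp: good_profile_def V_set_def Omega_set_def W_set_def)
qed

lemmas payoff_order = r_pos r01 r12 p_pos p12 p23 p1_r0 sum01 sum12 sum23 p1_r1 p2_r2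

lemma stage_payoff_triple:
  assumes "{i, j, k} = UNIV"
  shows "stage_payoff r p a $ l = (if a l = Invest then p else r)
    (of_bool (a i = Invest) + of_bool (a j = Invest) + of_bool (a k = Invest))"
  by (simp add: stage_payoff_def Let_def card_investors[OF assms])

text \<open>With \<open>n\<close> investors the abstaining player gets \<open>r n \<ge> r 0\<close>,
  and an investor gets \<open>p n < r n\<close>. The other two together get \<open>2 * r 0\<close>,
  \<open>p 1 + r 1\<close> or \<open>2 * p 2\<close>, each below \<open>2 * p 3\<close>.\<close>

lemma stage_payoff_NotInvest:
  assumes t: "{i, j, k} = UNIV" and a: "a i = NotInvest"
  shows "r 0 \<le> stage_payoff r p a $ i"
    and "stage_payoff r p a $ j \<le> stage_payoff r p a $ i"
    and "stage_payoff r p a $ j + stage_payoff r p a $ k \<le> 2 * p 3"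
proof -
  note u = stage_payoff_triple[OF t, of a i] stage_payoff_triple[OF t, of a j]
    stage_payoff_triple[OF t, of a k]
  have "r 0 \<le> stage_payoff r p a $ i \<and> stage_payoff r p a $ j \<le> stage_payoff r p a $ i
    \<and> stage_payoff r p a $ j + stage_payoff r p a $ k \<le> 2 * p 3"
    using payoff_order by (cases "a j"; cases "a k") (auto simp: u a numeral_2_eq_2 numeral_3_eq_3)
  then show "r 0 \<le> stage_payoff r p a $ i"
    "stage_payoff r p a $ j \<le> stage_payoff r p a $ i"
    "stage_payoff r p a $ j + stage_payoff r p a $ k \<le> 2 * p 3"
    by blast+
qed

text \<open>The total payoff increases with the number of investors, through the values
  \<open>3 * r 0\<close>, \<open>p 1 + 2 * r 1\<close>, \<open>2 * p 2 + r 2\<close>,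
  \<open>3 * p 3\<close>.\<close>

lemma stage_payoff_sum_bounds:
  "3 * r 0 \<le> (\<Sum>i\<in>UNIV. stage_payoff r p a $ i)"
  "(\<Sum>i\<in>UNIV. stage_payoff r p a $ i) \<le> 3 * p 3"
  "a i = Invest \<Longrightarrow> p 1 + 2 * r 1 \<le> (\<Sum>i\<in>UNIV. stage_payoff r p a $ i)"
  "a i = NotInvest \<Longrightarrow> (\<Sum>i\<in>UNIV. stage_payoff r p a $ i) \<le> 2 * p 2 + r 2"
proof -
  obtain j k where t: "{i, j, k} = UNIV"
    using ex_triple1 by blast
  note u = stage_payoff_triple[OF t, of a i] stage_payoff_triple[OF t, of a j]
    stage_payoff_triple[OF t, of a k]
  have "3 * r 0 \<le> (\<Sum>i\<in>UNIV. stage_payoff r p a $ i)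
    \<and> (\<Sum>i\<in>UNIV. stage_payoff r p a $ i) \<le> 3 * p 3
    \<and> (a i = Invest \<longrightarrow> p 1 + 2 * r 1 \<le> (\<Sum>i\<in>UNIV. stage_payoff r p a $ i))
    \<and> (a i = NotInvest \<longrightarrow> (\<Sum>i\<in>UNIV. stage_payoff r p a $ i) \<le> 2 * p 2 + r 2)"
    using payoff_order
    by (cases "a i"; cases "a j"; cases "a k") (auto simp: u sum_triple[OF t] numeral_2_eq_2 numeral_3_eq_3)
  then show "3 * r 0 \<le> (\<Sum>i\<in>UNIV. stage_payoff r p a $ i)"
    "(\<Sum>i\<in>UNIV. stage_payoff r p a $ i) \<le> 3 * p 3"
    "a i = Invest \<Longrightarrow> p 1 + 2 * r 1 \<le> (\<Sum>i\<in>UNIV. stage_payoff r p a $ i)"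
    "a i = NotInvest \<Longrightarrow> (\<Sum>i\<in>UNIV. stage_payoff r p a $ i) \<le> 2 * p 2 + r 2"
    by blast+
qed

lemma linear_coordinates:
  "linear (\<lambda>x::real^3. x $ i)" "linear (\<lambda>x::real^3. - x $ i)"
  "linear (\<lambda>x::real^3. x $ i + x $ j)" "linear (\<lambda>x::real^3. x $ i - x $ j)"
  "linear (\<lambda>x::real^3. \<Sum>i\<in>UNIV. x $ i)" "linear (\<lambda>x::real^3. - (\<Sum>i\<in>UNIV. x $ i))"
  by (auto intro!: linearI simp: sum.distrib sum_distrib_left algebra_simps)

lemma feasible_sum_bounds:
  assumes "x \<in> feasible r p"
  shows "3 * r 0 \<le> (\<Sum>i\<in>UNIV. x $ i)" "(\<Sum>i\<in>UNIV. x $ i) \<le> 3 * p 3"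
proof -
  let ?H = "(\<lambda>x::real^3. \<Sum>i\<in>UNIV. x $ i) -` {3 * r 0..3 * p 3}"
  have "convex ?H"
    by (rule convex_linear_vimage[OF linear_coordinates(5)]) simp
  then have "feasible r p \<subseteq> ?H"
    unfolding feasible_def by (intro hull_minimal) (auto simp: stage_payoff_sum_bounds)
  then show "3 * r 0 \<le> (\<Sum>i\<in>UNIV. x $ i)" "(\<Sum>i\<in>UNIV. x $ i) \<le> 3 * p 3"
    using assms by auto
qed

section \<open>What a player following the good strategy can enforce\<close>

context
  fixes s :: strategy_profile and x\<^sub>1 :: "real^3"
  assumes x\<^sub>1: "x\<^sub>1 \<in> feasible r p"
begin

abbreviation x where "x \<equiv> trajectory r p s x\<^sub>1"

lemma x_feasible: "x n \<in> feasible r p"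
  by (rule trajectory_in_feasible[OF x\<^sub>1])

lemma follows_action:
  assumes "follows r p \<epsilon> s i"
  shows "s i (x n) = good i (x n)"
  using assms x_feasible by (simp add: follows_def)

text \<open>Any one violated condition makes player \<open>i\<close> abstain, and abstaining yields
  all three stage inequalities at once.\<close>

lemma follower_NotInvest:
  assumes t: "{i, j, k} = UNIV" and i: "follows r p \<epsilon> s i"
    and out: "x n $ j - x n $ i \<ge> \<epsilon> \<or> x n $ i < r 0 \<or> x n $ j + x n $ k > 2 * p 3"
  shows "r 0 \<le> next_payoff r p s (x n) $ i"
    and "next_payoff r p s (x n) $ j \<le> next_payoff r p s (x n) $ i"
    and "next_payoff r p s (x n) $ j + next_payoff r p s (x n) $ k \<le> 2 * p 3"
proof -
  have "good i (x n) \<noteq> Invest"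
    unfolding good_Invest_iff[OF t x_feasible] using out by auto
  then have "s i (x n) = NotInvest"
    unfolding follows_action[OF i] by (cases "good i (x n)") auto
  then show "r 0 \<le> next_payoff r p s (x n) $ i"
    "next_payoff r p s (x n) $ j \<le> next_payoff r p s (x n) $ i"
    "next_payoff r p s (x n) $ j + next_payoff r p s (x n) $ k \<le> 2 * p 3"
    unfolding next_payoff_def by (intro stage_payoff_NotInvest[OF t]; simp)+
qed

text \<open>The drift argument with the thresholds \<open>2 * p 3\<close>, \<open>- r 0\<close> and
  \<open>\<epsilon>\<close>: beyond each of them the follower abstains. The other two players are
  arbitrary.\<close>

lemma follower_bounds:
  assumes t: "{i, j, k} = UNIV" and i: "follows r p \<epsilon> s i" and e: "0 < e"
  shows "\<forall>\<^sub>F n in sequentially. x n $ j + x n $ k \<le> 2 * p 3 + e"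
    and "\<forall>\<^sub>F n in sequentially. - x n $ i \<le> - r 0 + e"
    and "\<forall>\<^sub>F n in sequentially. x n $ j - x n $ i \<le> \<epsilon> + e"
proof -
  show "\<forall>\<^sub>F n in sequentially. x n $ j + x n $ k \<le> 2 * p 3 + e"
    by (rule trajectory_eventually_le[OF linear_coordinates(3) _ e])
      (rule follower_NotInvest(3)[OF t i], simp)
  show "\<forall>\<^sub>F n in sequentially. - x n $ i \<le> - r 0 + e"
    by (rule trajectory_eventually_le[OF linear_coordinates(2) _ e])
      (use follower_NotInvest(1)[OF t i] in simp)
  show "\<forall>\<^sub>F n in sequentially. x n $ j - x n $ i \<le> \<epsilon> + e"
  proof (rule trajectory_eventually_le[OF linear_coordinates(4) _ e])
    fix n assume "\<epsilon> < x n $ j - x n $ i"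
    then have "next_payoff r p s (x n) $ j \<le> next_payoff r p s (x n) $ i"
      by (intro follower_NotInvest(2)[OF t i]) simp
    then show "next_payoff r p s (x n) $ j - next_payoff r p s (x n) $ i \<le> \<epsilon>"
      using eps_pos by simp
  qed
qed

text \<open>Follower \<open>j\<close> controls \<open>x n $ i + x n $ k\<close>, follower
  \<open>k\<close> controls \<open>x n $ i - x n $ k\<close>. Adding and halving even gives
  \<open>\<epsilon> / 2\<close> in place of \<open>\<epsilon>\<close>.\<close>

lemma single_deviation_bound:
  assumes t: "{i, j, k} = UNIV" and j: "follows r p \<epsilon> s j" and k: "follows r p \<epsilon> s k"
    and e: "0 < e"
  shows "\<forall>\<^sub>F n in sequentially. x n $ i \<le> p 3 + \<epsilon> + e"
proof -
  have t': "{j, i, k} = UNIV" "{k, i, j} = UNIV"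
    using t by auto
  show ?thesis
    using follower_bounds(1)[OF t'(1) j e] follower_bounds(3)[OF t'(2) k e]
    by eventually_elim (use eps_pos in linarith)
qed

section \<open>Convergence when all players follow the good strategy\<close>

text \<open>Once \<open>n * c\<close> exceeds every possible change of a payoff difference, the largest value of
  \<open>n * (x n $ i - x n $ j)\<close> cannot grow any more: a non-investor gains on an investor, but it is
  too far behind to overtake the leader. This bounds the differences by a multiple of \<open>1 / n\<close>.\<close>

lemma lagging_not_forever:
  assumes never: "\<And>n. 1 \<le> n \<Longrightarrow> \<exists>i. s i (x n) = NotInvest"
    and c: "0 < c" "\<And>n i. N \<le> n \<Longrightarrow> s i (x n) = NotInvest \<Longrightarrow> \<exists>m. c \<le> x n $ m - x n $ i"
  shows False
proof -
  obtain M where M: "\<And>y. y \<in> feasible r p \<Longrightarrow> norm y \<le> M"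
    using bounded_feasible[of r p] by (auto simp: bounded_iff)
  obtain N' where N': "1 \<le> N'" "N \<le> N'" "2 * M \<le> real N' * c"
  proof -
    obtain l where "2 * M / c \<le> real l"
      using real_arch_simple by blast
    then have "2 * M \<le> real l * c"
      using c(1) by (simp add: field_simps)
    also have "\<dots> \<le> real (Suc (l + N)) * c"
      using c(1) by (intro mult_right_mono) auto
    finally show ?thesis
      by (intro that[of "Suc (l + N)"]) auto
  qed
  define B where "B = Max ((\<lambda>(i, j). real N' * (x N' $ i - x N' $ j)) ` UNIV)"
  have gap: "\<forall>i j. real n * (x n $ i - x n $ j) \<le> B" if "N' \<le> n" for n
    using that
  proof (induction n rule: dec_induct)
    case base
    show ?case
      unfolding B_def by (auto intro!: Max_ge image_eqI[where x = "(_, _)"])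
  next
    case (step n)
    have n: "1 \<le> n" "N \<le> n"
      using step N' by auto
    let ?y = "next_payoff r p s (x n)"
    have M': "\<bar>?y $ l\<bar> \<le> M" for l
      by (rule order_trans[OF component_le_norm_cart M[OF next_payoff_in_feasible]])
    have "real (Suc n) * (x (Suc n) $ i - x (Suc n) $ j) \<le> B" for i j
    proof -
      have e: "real (Suc n) * (x (Suc n) $ i - x (Suc n) $ j)
          = real n * (x n $ i - x n $ j) + (?y $ i - ?y $ j)"
        using excess_Suc[OF linear_coordinates(4)[of i j] n(1), of r p s x\<^sub>1 0]
        by (simp only: diff_0_right)
      show ?thesis
      proof (cases "s i (x n)")
        \<comment> \<open>The pair \<open>(m, j)\<close> is bounded by \<open>B\<close>, the pair
          \<open>(i, j)\<close> lies at least \<open>2 * M\<close> lower, and one step adds at most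
          \<open>2 * M\<close>.\<close>
        case NotInvest
        then obtain m where m: "c \<le> x n $ m - x n $ i"
          using c(2)[OF n(2)] by blast
        have "2 * M \<le> real n * c"
          by (rule order_trans[OF N'(3) mult_right_mono]) (use step.hyps c(1) in auto)
        also have "\<dots> \<le> real n * (x n $ m - x n $ i)"
          using m by (intro mult_left_mono) auto
        finally have "real n * (x n $ i - x n $ j) + 2 * M \<le> real n * (x n $ m - x n $ j)"
          by (simp add: algebra_simps)
        then show ?thesis
          using step.IH[rule_format, of m j] M'[of i] M'[of j] e by linarith
      next
        case Invest
        \<comment> \<open>In a stage an investor never earns more than another player.\<close>
        have "?y $ i \<le> ?y $ j"
        proof (cases "s j (x n)")
          case NotInvest
          with Invest have "j \<noteq> i"
            by auto
          then obtain k where "{j, i, k} = UNIV"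
            using ex_triple by blast
          then show ?thesis
            unfolding next_payoff_def using NotInvest by (intro stage_payoff_NotInvest(2)) auto
        qed (use Invest in \<open>simp add: next_payoff_def stage_payoff_def Let_def\<close>)
        then show ?thesis
          using step.IH[rule_format, of i j] e by linarith
      qed
    qed
    then show ?case
      by blast
  qed
  \<comment> \<open>Some player lags by \<open>c\<close> at every late time, so
    \<open>n * c \<le> B\<close>; this fails once \<open>n > B / c\<close>.\<close>
  obtain l where l: "B / c < real l"
    using reals_Archimedean2 by blast
  define n where "n = max l N'"
  have n: "N' \<le> n" "1 \<le> n" "N \<le> n"
    using N' by (auto simp: n_def)
  obtain i m where "c \<le> x n $ m - x n $ i"
    using never[OF n(2)] c(2)[OF n(3)] by blast
  then have "real n * c \<le> B"
    by (intro order_trans[OF mult_left_mono gap[OF n(1), rule_format, of m i]]) auto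
  moreover have "B < real l * c"
    using l c(1) by (simp add: field_simps)
  moreover have "real l * c \<le> real n * c"
    using c(1) by (intro mult_right_mono) (auto simp: n_def)
  ultimately show False
    by linarith
qed

text \<open>The witness is a player with the largest coordinate.\<close>

lemma ex_good_Invest:
  assumes "y \<in> feasible r p"
  shows "\<exists>m. good m y = Invest"
proof -
  obtain m where m: "\<And>l. y $ l \<le> y $ m"
  proof -
    have "Max (range (($) y)) \<in> range (($) y)"
      by (rule Max_in) auto
    then obtain m where "Max (range (($) y)) = y $ m"
      by blast
    then have "y $ l \<le> y $ m" for l
      using Max_ge[of "range (($) y)" "y $ l"] by simp
    then show ?thesis
      by (rule that)
  qed
  obtain j k where t: "{m, j, k} = UNIV"
    using ex_triple1 by blast
  \<comment> \<open>The largest coordinate is at least the mean, hence at least \<open>r 0\<close>;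
    the other two sum to at most two thirds of the total, hence to at most
    \<open>2 * p 3\<close>.\<close>
  have "good m y = Invest"
    unfolding good_Invest_iff[OF t assms]
    using feasible_sum_bounds[OF assms, unfolded sum_triple[OF t]] m[of j] m[of k] eps_pos
    by (intro conjI; linarith)
  then show ?thesis ..
qed

text \<open>If nobody were ahead of \<open>i\<close> by \<open>min \<epsilon> c\<close>, the
  coordinates \<open>y $ j\<close> and \<open>y $ k\<close> would exceed \<open>y $ i\<close> by
  less than \<open>c\<close> each. The margin \<open>3 * c\<close> in the total outweighs this, so
  every condition for investing would hold.\<close>

lemma good_NotInvest_lags:
  assumes y: "y \<in> feasible r p" and NI: "good i y = NotInvest"
    and sum: "3 * r 0 + 3 * c \<le> (\<Sum>i\<in>UNIV. y $ i)" "(\<Sum>i\<in>UNIV. y $ i) \<le> 3 * p 3 - 3 * c"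
    and c: "0 < c"
  shows "\<exists>m. min \<epsilon> c \<le> y $ m - y $ i"
proof -
  obtain j k where t: "{i, j, k} = UNIV"
    using ex_triple1 by blast
  note sum' = sum[unfolded sum_triple[OF t]]
  show ?thesis
  proof (rule ccontr)
    assume "\<not> ?thesis"
    then have "y $ j - y $ i < min \<epsilon> c" "y $ k - y $ i < min \<epsilon> c"
      by (auto simp: not_le)
    then have small: "y $ j - y $ i < \<epsilon>" "y $ k - y $ i < \<epsilon>" "y $ j - y $ i < c" "y $ k - y $ i < c"
      by simp_all
    have "r 0 \<le> y $ i"
      using small(3,4) sum'(1) c by linarith
    moreover have "y $ j + y $ k \<le> 2 * p 3"
      using small(3,4) sum'(2) c by linarith
    ultimately have "good i y = Invest"
      unfolding good_Invest_iff[OF t y] using small(1,2) by (simp add: algebra_simps)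
    then show False
      using NI by simp
  qed
qed

lemma eventually_all_invest:
  assumes follow: "\<And>i. follows r p \<epsilon> s i"
  shows "\<exists>n\<ge>1. \<forall>i. s i (x n) = Invest"
proof (rule ccontr)
  assume "\<not> ?thesis"
  then have never: "\<exists>i. s i (x n) = NotInvest" if "1 \<le> n" for n
    using that by (metis action.exhaust)
  \<comment> \<open>Of each gap, at least \<open>6 * c\<close>, one half is spent on the slack in
    the eventual bounds and the other half remains as the margin.\<close>
  define c where "c = min (p 1 + 2 * r 1 - 3 * r 0) (3 * p 3 - (2 * p 2 + r 2)) / 6"
  have c: "0 < c" "6 * c \<le> p 1 + 2 * r 1 - 3 * r 0" "6 * c \<le> 3 * p 3 - (2 * p 2 + r 2)"
    using sum01 sum23 by (auto simp: c_def)
  have c3: "0 < 3 * c"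
    using c by simp
  have "\<forall>\<^sub>F n in sequentially. (\<Sum>i\<in>UNIV. x n $ i) \<le> (2 * p 2 + r 2) + 3 * c"
    by (rule trajectory_eventually_le[OF linear_coordinates(5) _ c3])
      (metis never stage_payoff_sum_bounds(4) next_payoff_def)
  moreover have "\<forall>\<^sub>F n in sequentially. - (\<Sum>i\<in>UNIV. x n $ i) \<le> - (p 1 + 2 * r 1) + 3 * c"
  proof (rule trajectory_eventually_le[OF linear_coordinates(6) _ c3])
    fix n
    obtain m where "s m (x n) = Invest"
      using ex_good_Invest[OF x_feasible] follows_action[OF follow] by metis
    then show "- (\<Sum>i\<in>UNIV. next_payoff r p s (x n) $ i) \<le> - (p 1 + 2 * r 1)"
      unfolding next_payoff_def neg_le_iff_le by (rule stage_payoff_sum_bounds(3))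
  qed
  ultimately have "\<forall>\<^sub>F n in sequentially. 3 * r 0 + 3 * c \<le> (\<Sum>i\<in>UNIV. x n $ i)
      \<and> (\<Sum>i\<in>UNIV. x n $ i) \<le> 3 * p 3 - 3 * c"
    by eventually_elim (use c in linarith)
  then obtain N where N: "\<And>n. N \<le> n \<Longrightarrow> 3 * r 0 + 3 * c \<le> (\<Sum>i\<in>UNIV. x n $ i)
      \<and> (\<Sum>i\<in>UNIV. x n $ i) \<le> 3 * p 3 - 3 * c"
    by (auto simp: eventually_sequentially)
  show False
  proof (rule lagging_not_forever[OF never, where c = "min \<epsilon> c" and N = N])
    fix n i
    assume "N \<le> n" "s i (x n) = NotInvest"
    then show "\<exists>m. min \<epsilon> c \<le> x n $ m - x n $ i"
      using N c(1) follows_action[OF follow] by (intro good_NotInvest_lags[OF x_feasible]) auto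
  qed (use c eps_pos in auto)
qed

text \<open>Joint investment and the constancy of \<open>n * (x n $ i - p 3)\<close> sustain each
  other: the stage payoff is \<open>p 3\<close> for all, and contracting towards it preserves every
  condition for investing.\<close>

lemma all_good_tendsto:
  assumes follow: "\<And>i. follows r p \<epsilon> s i"
  shows "x \<longlonglongrightarrow> (\<chi> i. p 3)"
proof -
  obtain N where N: "1 \<le> N" "\<And>i. s i (x N) = Invest"
    using eventually_all_invest[OF follow] by blast
  have inv: "(\<forall>i. s i (x n) = Invest) \<and> (\<forall>i. real n * (x n $ i - p 3) = real N * (x N $ i - p 3))"
    if "N \<le> n" for n
    using that
  proof (induction n rule: dec_induct)
    case base
    then show ?case
      using N by simp
  next
    case (step n)
    have n: "1 \<le> n"
      using step N by auto
    have y: "next_payoff r p s (x n) $ i = p 3" for i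
      using step.IH by (simp add: next_payoff_def stage_payoff_def)
    have e: "real (Suc n) * (x (Suc n) $ i - p 3) = real n * (x n $ i - p 3)" for i
      using excess_Suc[OF linear_coordinates(1)[of i] n, of r p s x\<^sub>1 "p 3"] y by simp
    have "s i (x (Suc n)) = Invest" for i
    proof -
      obtain j k where t: "{i, j, k} = UNIV"
        using ex_triple1 by blast
      define q where "q = real n / real (Suc n)"
      have q: "0 \<le> q" "q \<le> 1"
        by (auto simp: q_def)
      have shrink: "x (Suc n) $ l = p 3 + q * (x n $ l - p 3)" for l
        using e[of l] by (simp add: q_def field_simps del: trajectory.simps)
      have good: "good i (x n) = Invest"
        using step.IH follows_action[OF follow] by simp
      note g = good[unfolded good_Invest_iff[OF t x_feasible]]
      \<comment> \<open>Scaling by \<open>q\<close> does not increase a nonnegative \<open>d\<close>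
        and keeps a negative one nonpositive.\<close>
      have "q * d < \<epsilon>" if "d < \<epsilon>" for d
      proof (cases "0 \<le> d")
        case True
        then show ?thesis
          using mult_left_le_one_le[OF True q] that by linarith
      next
        case False
        then show ?thesis
          using mult_nonneg_nonpos[OF q(1), of d] eps_pos by linarith
      qed
      then have "q * (x n $ j - x n $ i) < \<epsilon>" "q * (x n $ k - x n $ i) < \<epsilon>"
        using g by simp_all
      moreover have "q * (r 0 - p 3) \<le> q * (x n $ i - p 3)"
        using g q by (intro mult_left_mono) auto
      moreover have "1 * (r 0 - p 3) \<le> q * (r 0 - p 3)"
        using q payoff_order by (intro mult_right_mono_neg) auto
      moreover have "q * (x n $ j + x n $ k - 2 * p 3) \<le> 0"
        using g q by (intro mult_nonneg_nonpos) auto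
      ultimately have "good i (x (Suc n)) = Invest"
        unfolding good_Invest_iff[OF t x_feasible] shrink by (simp add: algebra_simps)
      then show ?thesis
        by (simp add: follows_action[OF follow] del: trajectory.simps)
    qed
    then show ?case
      using e step.IH by simp
  qed
  show ?thesis
  proof (rule vec_tendstoI)
    fix i
    \<comment> \<open>This is the invariant solved for \<open>x n $ i\<close>.\<close>
    have "(\<lambda>n. p 3 + real N * (x N $ i - p 3) / real n) \<longlonglongrightarrow> p 3 + 0"
      by (intro tendsto_add tendsto_const lim_const_over_n)
    moreover have "\<forall>\<^sub>F n in sequentially. p 3 + real N * (x N $ i - p 3) / real n = x n $ i"
      using eventually_ge_at_top[of N]
    proof eventually_elim
      case (elim n)
      then show ?case
        using inv[OF elim] N(1) by (simp add: field_simps)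
    qed
    ultimately show "(\<lambda>n. x n $ i) \<longlonglongrightarrow> (\<chi> i. p 3) $ i"
      by (simp add: filterlim_cong[OF refl refl])
  qed
qed

text \<open>The third follower bound, for both opponents, combined with compactness. The target set
  is nonempty: it contains the point with all coordinates \<open>p 3\<close>.\<close>

lemma follower_infdist_tendsto_0:
  assumes t: "{i, j, k} = UNIV" and i: "follows r p \<epsilon> s i"
  shows "(\<lambda>n. infdist (x n)
    {y \<in> feasible r p. y $ j \<le> y $ i + \<epsilon> \<and> y $ k \<le> y $ i + \<epsilon>}) \<longlonglongrightarrow> 0"
proof -
  have t': "{i, k, j} = UNIV"
    using t by auto
  have "(\<lambda>n. infdist (x n)
    {y \<in> feasible r p. y $ j - y $ i - \<epsilon> \<le> 0 \<and> y $ k - y $ i - \<epsilon> \<le> 0}) \<longlonglongrightarrow> 0"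
    using follower_bounds(3)[OF t i] follower_bounds(3)[OF t' i]
    by (intro infdist_sublevel_tendsto_0[OF compact_feasible x_feasible] continuous_intros)
      (simp_all add: diff_le_eq add.commute)
  then show ?thesis
    by (simp add: algebra_simps)
qed

end

section \<open>Banach limit payoffs and the equilibrium properties\<close>

context
  fixes L assumes L: "banach_limit L"
begin

text \<open>The arbitrarily small slack of the eventual bounds vanishes in the Banach limit.\<close>

lemma payoff_follower:
  assumes x\<^sub>1: "x\<^sub>1 \<in> feasible r p" and t: "{i, j, k} = UNIV" and i: "follows r p \<epsilon> s i"
  shows "repeated_payoff L r p s x\<^sub>1 $ j + repeated_payoff L r p s x\<^sub>1 $ k \<le> 2 * p 3"
    and "r 0 \<le> repeated_payoff L r p s x\<^sub>1 $ i"
    and "repeated_payoff L r p s x\<^sub>1 $ j \<le> repeated_payoff L r p s x\<^sub>1 $ i + \<epsilon>"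
  using banach_limit_linear_le[OF L x\<^sub>1 linear_coordinates(3) follower_bounds(1)[OF x\<^sub>1 t i]]
    banach_limit_linear_le[OF L x\<^sub>1 linear_coordinates(2) follower_bounds(2)[OF x\<^sub>1 t i]]
    banach_limit_linear_le[OF L x\<^sub>1 linear_coordinates(4) follower_bounds(3)[OF x\<^sub>1 t i]]
  by simp_all

lemma safe_good: "safe_profile L r p \<epsilon> good"
  unfolding safe_profile_def
proof (intro ballI allI impI)
  fix x\<^sub>1 i s
  assume x\<^sub>1: "x\<^sub>1 \<in> feasible r p" and "\<forall>x\<in>feasible r p. s i x = good i x"
  then have i: "follows r p \<epsilon> s i"
    by (simp add: follows_def)
  have "repeated_payoff L r p s x\<^sub>1 $ j \<le> repeated_payoff L r p s x\<^sub>1 $ i + \<epsilon>" if "j \<noteq> i" for j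
    using ex_triple[of i j] that payoff_follower(3)[OF x\<^sub>1 _ i] by blast
  then show "r 0 \<le> repeated_payoff L r p s x\<^sub>1 $ i \<and>
      (\<forall>j. j \<noteq> i \<longrightarrow> repeated_payoff L r p s x\<^sub>1 $ j \<le> repeated_payoff L r p s x\<^sub>1 $ i + \<epsilon>)"
    using ex_triple1[of i] payoff_follower(2)[OF x\<^sub>1 _ i] by blast
qed

lemma payoff_good:
  assumes x\<^sub>1: "x\<^sub>1 \<in> feasible r p"
  shows "repeated_payoff L r p good x\<^sub>1 $ i = p 3"
proof -
  have "(\<lambda>n. trajectory r p good x\<^sub>1 (Suc n) $ i) \<longlonglongrightarrow> p 3"
    using tendsto_vec_nth[OF all_good_tendsto[OF x\<^sub>1, of good], of i]
    by (subst filterlim_sequentially_Suc) (simp add: follows_def)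
  then have "apply_bcontfun (Bcontfun (\<lambda>n. trajectory r p good x\<^sub>1 (Suc n) $ i)) \<longlonglongrightarrow> p 3"
    by (subst tendsto_cong[OF always_eventually])
      (auto simp: apply_Bcontfun_trajectory[OF x\<^sub>1] simp del: trajectory.simps)
  then show ?thesis
    using L by (simp add: banach_limit_def repeated_payoff_def del: trajectory.simps)
qed

text \<open>Suppose every member of \<open>K\<close> gains more than \<open>\<epsilon>\<close> over
  \<open>p 3\<close>. The grand coalition would exceed the total \<open>3 * p 3\<close>, and two
  deviators the bound \<open>2 * p 3\<close> enforced by the third player.\<close>

lemma strong_good: "strong_eps_Nash L r p \<epsilon> good"
  unfolding strong_eps_Nash_def
proof (intro ballI allI impI)
  fix x\<^sub>1 s and K :: "3 set"
  assume x\<^sub>1: "x\<^sub>1 \<in> feasible r p" and "K \<noteq> {}"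
    and "\<forall>l. l \<notin> K \<longrightarrow> (\<forall>x\<in>feasible r p. s l x = good l x)"
  then have follow: "follows r p \<epsilon> s l" if "l \<notin> K" for l
    using that by (simp add: follows_def)
  let ?u = "repeated_payoff L r p s x\<^sub>1"
  show "\<exists>i\<in>K. ?u $ i \<le> repeated_payoff L r p good x\<^sub>1 $ i + \<epsilon>"
    unfolding payoff_good[OF x\<^sub>1]
  proof (rule ccontr)
    assume "\<not> (\<exists>i\<in>K. ?u $ i \<le> p 3 + \<epsilon>)"
    then have large: "p 3 + \<epsilon> < ?u $ i" if "i \<in> K" for i
      using that by force
    show False
    proof (cases "K = UNIV")
      case True
      have "(\<Sum>i\<in>UNIV. ?u $ i) \<le> 3 * p 3"
        by (rule banach_limit_linear_le[OF L x\<^sub>1 linear_coordinates(5)])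
          (rule always_eventually, use feasible_sum_bounds(2)[OF trajectory_in_feasible[OF x\<^sub>1]]
            in \<open>smt (verit)\<close>)
      then show False
        using large[of 1] large[of 2] large[of 3] True eps_pos by (simp add: sum_3)
    next
      case False
      then obtain i j where i: "i \<notin> K" and j: "j \<in> K"
        using \<open>K \<noteq> {}\<close> by blast
      then obtain k where t: "{i, j, k} = UNIV"
        using ex_triple[of i j] by metis
      have t': "{k, j, i} = UNIV"
        using t by auto
      note jk = payoff_follower(1)[OF x\<^sub>1 t follow[OF i]]
      show False
      proof (cases "k \<in> K")
        case True
        then show False
          using large[OF j] large[of k] jk eps_pos by simp
      next
        \<comment> \<open>The only deviator is \<open>j\<close>; since \<open>k\<close> follows, its
          payoff is within \<open>\<epsilon>\<close> of that of \<open>j\<close>, so the bound on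
          their sum is violated again.\<close>
        case False
        then show False
          using payoff_follower(3)[OF x\<^sub>1 t' follow] large[OF j] jk eps_pos by fastforce
      qed
    qed
  qed
qed

end

end

theorem corollary3p4:
  fixes r p :: "nat \<Rightarrow> real" and \<epsilon> :: real
  assumes "0 < r 0" and "r 0 < r 1" and "r 1 < r 2"
    and "0 < p 1" and "p 1 < p 2" and "p 2 < p 3"
    and "p 1 < r 0"
    and "3 * r 0 < p 1 + 2 * r 1" and "p 1 + 2 * r 1 < 2 * p 2 + r 2"
    and "2 * p 2 + r 2 < 3 * p 3"
    and "p 1 + r 1 < 2 * p 3"
    and "p 2 < r 2"
    and "\<epsilon> > 0"
  shows "(\<forall>x\<^sub>1 \<in> feasible r p.
      (trajectory r p (good_profile r p \<epsilon>) x\<^sub>1 \<longlonglongrightarrow> (\<chi> i. p 3)) \<and>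
      (\<forall>i (s\<^sub>i :: strategy).
        let x = trajectory r p ((good_profile r p \<epsilon>)(i := s\<^sub>i)) x\<^sub>1 in
          limsup (\<lambda>n. ereal (x n $ i)) \<le> ereal (p 3 + \<epsilon>)) \<and>
      (\<forall>i j k (s\<^sub>j :: strategy) (s\<^sub>k :: strategy). {i, j, k} = UNIV \<longrightarrow>
        (let x = trajectory r p ((good_profile r p \<epsilon>)(j := s\<^sub>j, k := s\<^sub>k)) x\<^sub>1 in
          limsup (\<lambda>n. ereal (x n $ j + x n $ k)) \<le> ereal (2 * p 3) \<and>
          liminf (\<lambda>n. ereal (x n $ i)) \<ge> ereal (r 0) \<and>
          (\<lambda>n. infdist (x n)
            {y \<in> feasible r p. y $ j \<le> y $ i + \<epsilon> \<and> y $ k \<le> y $ i + \<epsilon>}) \<longlonglongrightarrow> 0)))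
    \<and> (\<forall>L. banach_limit L \<longrightarrow>
        safe_profile L r p \<epsilon> (good_profile r p \<epsilon>) \<and>
        strong_eps_Nash L r p \<epsilon> (good_profile r p \<epsilon>))"
proof -
  interpret investment_game r p \<epsilon>
    by unfold_locales (use assms in auto)
  show ?thesis
    unfolding Let_def
  proof (intro conjI ballI allI impI)
    fix x\<^sub>1
    assume x\<^sub>1: "x\<^sub>1 \<in> feasible r p"
    show "trajectory r p good x\<^sub>1 \<longlonglongrightarrow> (\<chi> i. p 3)"
      by (rule all_good_tendsto[OF x\<^sub>1]) (simp add: follows_def)
    show "limsup (\<lambda>n. ereal (trajectory r p (good(i := s\<^sub>i)) x\<^sub>1 n $ i)) \<le> ereal (p 3 + \<epsilon>)"
      for i s\<^sub>i
    proof -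
      obtain j k where t: "{i, j, k} = UNIV"
        using ex_triple1 by blast
      show ?thesis
        by (intro limsup_le_of_eventually single_deviation_bound[OF x\<^sub>1 t])
          (use triple_distinct[OF t] in \<open>auto simp: follows_def\<close>)
    qed
    fix i j k :: 3 and s\<^sub>j s\<^sub>k :: strategy
    assume t: "{i, j, k} = UNIV"
    let ?s = "good(j := s\<^sub>j, k := s\<^sub>k)"
    \<comment> \<open>Distinctness ensures that the updates at \<open>j\<close> and \<open>k\<close>
      leave player \<open>i\<close> unchanged.\<close>
    have i: "follows r p \<epsilon> ?s i"
      using triple_distinct[OF t] by (simp add: follows_def)
    note bounds = follower_bounds[OF x\<^sub>1 t i]
    show "limsup (\<lambda>n. ereal (trajectory r p ?s x\<^sub>1 n $ j + trajectory r p ?s x\<^sub>1 n $ k))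
        \<le> ereal (2 * p 3)"
      by (intro limsup_le_of_eventually bounds(1))
    show "ereal (r 0) \<le> liminf (\<lambda>n. ereal (trajectory r p ?s x\<^sub>1 n $ i))"
    proof (rule liminf_ge_of_eventually)
      fix e :: real
      assume "0 < e"
      then show "\<forall>\<^sub>F n in sequentially. r 0 \<le> trajectory r p ?s x\<^sub>1 n $ i + e"
        by (rule eventually_mono[OF bounds(2)]) simp
    qed
    show "(\<lambda>n. infdist (trajectory r p ?s x\<^sub>1 n)
        {y \<in> feasible r p. y $ j \<le> y $ i + \<epsilon> \<and> y $ k \<le> y $ i + \<epsilon>}) \<longlonglongrightarrow> 0"
      by (rule follower_infdist_tendsto_0[OF x\<^sub>1 t i])
  qed (simp_all add: safe_good strong_good)
qed

end
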